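(* Let $\eta\in\mathbb{R}$, $\lambda>-1/2$, $b=\lambda+i\eta$, and consider the weight function on the unit circle $$w(\theta)=\tau(b)\,e^{-\eta\theta}[\sin^2(\theta/2)]^{\lambda},\quad\theta\in[0,2\pi],\qquad \tau(b)=\frac{e^{\pi\eta}\,2^{b+\overline b}\,|\Gamma(b+1)|^2}{2\pi\,\Gamma(b+\overline b+1)}.$$ The associated Verblunsky coefficients $\alpha_n$ satisfy the following difference equations: $$(b+n+1)\alpha_n=[n+2+\overline b-(b+n+1)\overline{\alpha}_{n+1}\alpha_n]\,\frac{\alpha_{n+1}}{1-|\alpha_{n+1}|^2},\quad n\ge0,$$ $$(\overline b+n+1)\alpha_n=(b+n)\alpha_{n-1},\quad n\ge1,$$ $$(\overline b+n+1)\alpha_n+(b+n-1)\alpha_{n-2}=\frac{2[\operatorname{Re}(\gamma_n)+n]\,\alpha_{n-1}}{1-|\alpha_{n-1}|^2},\quad n\ge2,$$ $$(\overline b+n+1)\alpha_n-(b+n-1)\alpha_{n-2}=-\frac{2i\operatorname{Im}(\gamma_n)\,\alpha_{n-1}}{1-|\alpha_{n-1}|^2},\quad n\ge2,$$ $$(\overline b+n+1)\alpha_n+(b+n-1)(1-|\alpha_{n-1}|^2)\alpha_{n-2}=\Big(\frac{n\overline b}{b+n}+b+2n\Big)\alpha_{n-1},\quad n\ge2,$$ $$(\overline b+n+1)\alpha_n-(b+n-1)(1-|\alpha_{n-1}|^2)\alpha_{n-2}=-\Big(\frac{n\overline b}{b+n}-b\Big)\alpha_{n-1},\quad n\ge2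.$$
   Context: For a weight function $w$ on $[0,2\pi]$, put $\langle f,g\rangle=\int_0^{2\pi}f(e^{i\theta})\overline{g(e^{i\theta})}\,w(\theta)\,d\theta$. The monic orthogonal polynomials on the unit circle $\Phi_n$ ($n\ge0$) are the monic polynomials of degree $n$ with $\langle\Phi_n,z^k\rangle=0$ for $0\le k\le n-1$. The Verblunsky coefficients are $\alpha_{n-1}=-\overline{\Phi_n(0)}$ for $n\ge0$ (so $\alpha_{-1}=-1$). Set $\gamma_n=\sum_{j=0}^{n-1}\overline{\alpha}_j\alpha_{j-1}$ for $n\ge1$. *)

theory Defs
  imports "HOL-Analysis.Analysis" "HOL-Computational_Algebra.Polynomial"
begin

definition circle_inner :: "(real \<Rightarrow> real) \<Rightarrow> (complex \<Rightarrow> complex) \<Rightarrow> (complex \<Rightarrow> complex) \<Rightarrow> complex" where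
  "circle_inner w f g =
     (LINT \<theta>:{0..2*pi}|lborel. f (cis \<theta>) * cnj (g (cis \<theta>)) * complex_of_real (w \<theta>))"

definition monic_opuc :: "(real \<Rightarrow> real) \<Rightarrow> nat \<Rightarrow> complex poly" where
  "monic_opuc w n = (THE p. degree p = n \<and> lead_coeff p = 1 \<and>
     (\<forall>k<n. circle_inner w (poly p) (\<lambda>z. z ^ k) = 0))"

text \<open>Integer indices make room for \<open>\<alpha>\<^sub>-\<^sub>1 = -1\<close>; the definition is only meaningful for
  indices \<open>k \<ge> -1\<close>.\<close>

definition verblunsky :: "(real \<Rightarrow> real) \<Rightarrow> int \<Rightarrow> complex" where
  "verblunsky w k = - cnj (poly (monic_opuc w (nat (k + 1))) 0)"

definition verblunsky_sum :: "(real \<Rightarrow> real) \<Rightarrow> nat \<Rightarrow> complex" where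
  "verblunsky_sum w n = (\<Sum>j<n. cnj (verblunsky w (int j)) * verblunsky w (int j - 1))"

text \<open>The normalising constant is a real number: \<open>b + cnj b\<close> is real, so the power of 2 and the
  Gamma function in the denominator are taken over the reals.\<close>

definition tau :: "complex \<Rightarrow> real" where
  "tau b = exp (pi * Im b) * 2 powr Re (b + cnj b) * (cmod (Gamma (b + 1)))\<^sup>2 /
     (2 * pi * Gamma (Re (b + cnj b) + 1))"

end

theory Submission
  imports Defs
begin

text \<open>
  All six equations follow from one closed formula,
  \<open>\<alpha>\<^sub>n\<^sub>-\<^sub>1 = - (b)\<^sub>n / (cnj b + 1)\<^sub>n\<close> (rising factorials), and the closed formula follows from a
  differential equation for the weight.

  Put \<open>z = e\<^sup>i\<^sup>\<theta>\<close>. The weight satisfies the Pearson equation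
  \<open>(z - 1) w' = \<i> (b z + cnj b) w\<close>, and since \<open>\<lambda> > - 1/2\<close> the product \<open>(z - 1) w\<close> tends to 0 at
  both ends of \<open>[0, 2\<pi>]\<close>. Integrating the derivative of \<open>(z - 1) z\<^sup>-\<^sup>k p(z) w\<close> over the circle
  therefore gives 0, which is the identity
  \<open>\<langle>(cnj b + (b + 1) z) p + z (z - 1) p', z\<^sup>k\<rangle> = k \<langle>(z - 1) p, z\<^sup>k\<rangle>\<close>
  for every polynomial \<open>p\<close> (lemma \<open>circular_jacobi_weight_by_parts\<close>). It suggests the raising
  operator \<open>P\<^sub>n\<^sub>+\<^sub>1 = (cnj b + n + (b + 1) z) P\<^sub>n + z (z - 1) P\<^sub>n'\<close> with \<open>P\<^sub>0 = 1\<close>, for which the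
  identity becomes
  \<open>\<langle>P\<^sub>n\<^sub>+\<^sub>1, z\<^sup>k\<rangle> = (n - k) \<langle>P\<^sub>n, z\<^sup>k\<rangle> + k \<langle>P\<^sub>n, z\<^sup>k\<^sup>-\<^sup>1\<rangle>\<close>.
  If \<open>P\<^sub>n\<close> is orthogonal to \<open>z\<^sup>0, \<dots>, z\<^sup>n\<^sup>-\<^sup>1\<close>, then for \<open>k \<le> n\<close> each term on the right vanishes,
  either by orthogonality or through its factor. So \<open>P\<^sub>n\<close> is a multiple of the orthogonal
  polynomial; the recursion gives its leading coefficient \<open>(b + 1)\<^sub>n\<close> and its value \<open>(cnj b)\<^sub>n\<close> at 0,
  and the quotient of the two is \<open>\<Phi>\<^sub>n(0)\<close>.

  From the closed formula, \<open>|\<alpha>\<^sub>n\<^sub>-\<^sub>1|\<^sup>2 = |b|\<^sup>2 / |b + n|\<^sup>2\<close> for \<open>n \<ge> 1\<close>, and the sum \<open>\<gamma>\<^sub>n\<close> telescopes to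
  \<open>n cnj b / (b + n)\<close>. Hence \<open>\<gamma>\<^sub>n + n = (cnj b + n) (1 - |\<alpha>\<^sub>n\<^sub>-\<^sub>1|\<^sup>2)\<close>; its real and imaginary parts, together
  with the two-term recurrence for \<open>\<alpha>\<^sub>n\<close>, yield the stated equations.
\<close>

section \<open>Orthogonality for a positive integrable weight\<close>

lemma inj_on_cis_circle: "inj_on cis {0<..<2 * pi}"
proof (rule inj_onI)
  fix x y :: real assume x: "x \<in> {0<..<2 * pi}" and y: "y \<in> {0<..<2 * pi}" and "cis x = cis y"
  then have "sin x = sin y \<and> cos x = cos y"
    by (metis cis.simps(1,2))
  then obtain n :: int where n: "x = y + 2 * pi * n"
    using sin_cos_eq_iff[of x y] by auto
  with x y have "\<bar>2 * pi * n\<bar> < 2 * pi * 1" by auto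
  then have "\<bar>real_of_int n\<bar> < 1" by (simp add: abs_mult)
  with n show "x = y" by simp
qed

lemma set_integrable_continuous_mult_weight:
  fixes g :: "real \<Rightarrow> complex" and w :: "real \<Rightarrow> real"
  assumes w: "set_integrable lborel {a..b} w" and g: "continuous_on UNIV g"
  shows "set_integrable lborel {a..b} (\<lambda>\<theta>. g \<theta> * complex_of_real (w \<theta>))"
proof -
  have "bounded (g ` {a..b})"
    by (intro compact_imp_bounded compact_continuous_image continuous_on_subset[OF g]) auto
  then obtain B where B: "\<And>\<theta>. \<theta> \<in> {a..b} \<Longrightarrow> norm (g \<theta>) \<le> B" by (metis bounded_iff imageI)
  have [measurable]: "g \<in> borel_measurable borel"
    using g by (simp add: borel_measurable_continuous_onI)
  have meas: "(\<lambda>\<theta>. indicator {a..b} \<theta> *\<^sub>R w \<theta>) \<in> borel_measurable lborel"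
    using w unfolding set_integrable_def by (rule borel_measurable_integrable)
  have eq: "indicator {a..b} \<theta> *\<^sub>R (g \<theta> * complex_of_real (w \<theta>)) =
      g \<theta> * complex_of_real (indicator {a..b} \<theta> *\<^sub>R w \<theta>)" for \<theta>
    by (simp add: indicator_def)
  show ?thesis
  proof (rule set_integrable_bound)
    show "set_integrable lborel {a..b} (\<lambda>\<theta>. B * w \<theta>)" using w by simp
    show "set_borel_measurable lborel {a..b} (\<lambda>\<theta>. g \<theta> * complex_of_real (w \<theta>))"
      unfolding set_borel_measurable_def eq using meas by measurable
    show "AE \<theta> in lborel. \<theta> \<in> {a..b} \<longrightarrow> norm (g \<theta> * complex_of_real (w \<theta>)) \<le> norm (B * w \<theta>)"
      using B by (intro AE_I2) (fastforce simp: norm_mult abs_mult intro!: mult_right_mono)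
  qed
qed

lemma continuous_on_poly_cis [continuous_intros]:
  "continuous_on A (\<lambda>\<theta>. poly p (cis \<theta>))"
  by (intro continuous_intros continuous_on_poly continuous_on_cis)

lemma circle_inner_set_integrable:
  assumes "set_integrable lborel {0..2*pi} w"
  shows "set_integrable lborel {0..2*pi}
    (\<lambda>\<theta>. poly p (cis \<theta>) * cnj (poly q (cis \<theta>)) * complex_of_real (w \<theta>))"
  by (intro set_integrable_continuous_mult_weight assms continuous_intros)

lemma circle_inner_power: "circle_inner w f (\<lambda>z. z ^ k) = circle_inner w f (poly (monom 1 k))"
  by (simp add: circle_inner_def poly_monom)

context
  fixes w :: "real \<Rightarrow> real"
  assumes w_int: "set_integrable lborel {0..2*pi} w"
begin

lemma circle_inner_poly_add:
  "circle_inner w (poly (p + q)) (poly r) =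
    circle_inner w (poly p) (poly r) + circle_inner w (poly q) (poly r)"
  unfolding circle_inner_def
  by (simp add: distrib_right set_integral_add(2) circle_inner_set_integrable[OF w_int])

lemma circle_inner_poly_smult:
  "circle_inner w (poly (smult c p)) g = c * circle_inner w (poly p) g"
  unfolding circle_inner_def
  by (subst set_integral_mult_right[symmetric]) (simp add: mult.assoc)

lemma circle_inner_poly_diff:
  "circle_inner w (poly (p - q)) (poly r) =
    circle_inner w (poly p) (poly r) - circle_inner w (poly q) (poly r)"
  using circle_inner_poly_add[of p "smult (-1) q" r] circle_inner_poly_smult[of "-1" q]
  by simp

lemma circle_inner_poly_sum_right:
  "finite A \<Longrightarrow> circle_inner w (poly p) (\<lambda>z. \<Sum>k\<in>A. c k * z ^ k) =
    (\<Sum>k\<in>A. cnj (c k) * circle_inner w (poly p) (\<lambda>z. z ^ k))"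
proof (induction A rule: finite_induct)
  case (insert x A)
  have 1: "poly (\<Sum>k\<in>A. monom (c k) k) = (\<lambda>z. \<Sum>k\<in>A. c k * z ^ k)" for A
    by (auto simp: poly_sum poly_monom)
  have "circle_inner w (poly p) (\<lambda>z. \<Sum>k\<in>insert x A. c k * z ^ k) =
     circle_inner w (poly p) (\<lambda>z. c x * z ^ x + (\<Sum>k\<in>A. c k * z ^ k))"
    using insert by simp
  also have "\<dots> = circle_inner w (poly p) (\<lambda>z. c x * z ^ x) +
     circle_inner w (poly p) (\<lambda>z. (\<Sum>k\<in>A. c k * z ^ k))"
    using circle_inner_set_integrable[OF w_int, of p "monom (c x) x"]
      circle_inner_set_integrable[OF w_int, of p "\<Sum>k\<in>A. monom (c k) k"]
    unfolding circle_inner_def 1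
    by (subst set_integral_add(2)[symmetric]) (auto simp: poly_monom algebra_simps)
  also have "circle_inner w (poly p) (\<lambda>z. c x * z ^ x) =
      cnj (c x) * circle_inner w (poly p) (\<lambda>z. z ^ x)"
    unfolding circle_inner_def
    by (subst set_integral_mult_right[symmetric]) (simp add: mult_ac)
  finally show ?case using insert by simp
qed (simp add: circle_inner_def)

text \<open>Such an \<open>r\<close> is orthogonal to itself, so \<open>|r|\<^sup>2 w\<close> is a nonnegative function with integral 0.
  It is positive off the finitely many angles where \<open>r\<close> has a root, unless \<open>r\<close> is zero.\<close>

lemma orthogonal_to_powers_imp_zero:
  assumes pos: "\<And>\<theta>. \<theta> \<in> {0<..<2*pi} \<Longrightarrow> w \<theta> > 0"
    and orth: "\<And>k. k \<le> degree r \<Longrightarrow> circle_inner w (poly r) (\<lambda>z. z ^ k) = 0"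
  shows "r = 0"
proof (rule ccontr)
  assume "r \<noteq> 0"
  define Z where "Z = {\<theta> \<in> {0<..<2*pi}. poly r (cis \<theta>) = 0}"
  have "finite (cis ` Z)"
    by (rule finite_subset[OF _ poly_roots_finite[OF \<open>r \<noteq> 0\<close>]]) (auto simp: Z_def)
  then have fin: "finite Z"
    by (rule finite_imageD) (rule inj_on_subset[OF inj_on_cis_circle], auto simp: Z_def)
  then have Znull: "Z \<in> null_sets lborel" by (rule finite_imp_null_set_lborel)
  define A where "A = {0<..<2*pi} - Z"
  have A: "A \<in> sets lborel" using Znull by (auto simp: A_def)
  have "circle_inner w (poly r) (poly r) = circle_inner w (poly r) (\<lambda>z. \<Sum>k\<le>degree r. coeff r k * z ^ k)"
    by (simp add: poly_altdef[abs_def])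
  also have "\<dots> = 0" by (subst circle_inner_poly_sum_right) (auto simp: orth)
  finally have 0: "circle_inner w (poly r) (poly r) = 0" .
  define f where "f = (\<lambda>\<theta>. (cmod (poly r (cis \<theta>)))\<^sup>2 * w \<theta>)"
  have sq: "poly r (cis \<theta>) * cnj (poly r (cis \<theta>)) * complex_of_real (w \<theta>) = complex_of_real (f \<theta>)" for \<theta>
    by (simp add: f_def flip: complex_norm_square)
  have "set_integrable lborel {0..2*pi} (\<lambda>\<theta>. complex_of_real (f \<theta>))"
    using circle_inner_set_integrable[OF w_int, of r r] by (simp only: sq)
  then have int: "set_integrable lborel {0..2*pi} f"
    unfolding set_integrable_def
    by (simp add: complex_of_real_integrable_eq scaleR_conv_of_real flip: of_real_mult)
  have "complex_of_real (LINT \<theta>:{0..2*pi}|lborel. f \<theta>) = 0"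
    using 0 unfolding circle_inner_def sq set_integral_complex_of_real .
  then have "(LINT \<theta>:{0..2*pi}|lborel. f \<theta>) = 0" by simp
  also have "(LINT \<theta>:{0..2*pi}|lborel. f \<theta>) = (LINT \<theta>:A|lborel. f \<theta>)"
  proof -
    have "({0..2*pi} - A) \<subseteq> insert 0 (insert (2*pi) Z)" "A \<subseteq> {0..2*pi}" by (auto simp: A_def)
    then show ?thesis
      using fin by (intro set_integral_discrete_difference[where X = "insert 0 (insert (2*pi) Z)"])
         (auto intro: countable_finite)
  qed
  finally have intA0: "(LINT \<theta>:A|lborel. f \<theta>) = 0" .
  have intA: "set_integrable lborel A f"
    by (rule set_integrable_subset[OF int A]) (auto simp: A_def)
  have "A \<in> null_sets lborel"
  proof (rule null_if_pos_func_has_zero_int)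
    show "integrable lborel (\<lambda>\<theta>. indicator A \<theta> *\<^sub>R f \<theta>)" using intA by (simp add: set_integrable_def)
    show "AE \<theta>\<in>A in lborel. 0 < indicator A \<theta> *\<^sub>R f \<theta>"
      using pos by (intro AE_I2) (auto simp: f_def A_def Z_def)
    show "(LINT \<theta>:A|lborel. indicator A \<theta> *\<^sub>R f \<theta>) = 0"
      using intA0 A by (subst set_lebesgue_integral_cong[where g = f]) auto
  qed (use A in auto)
  then have "A \<union> Z \<in> null_sets lborel" using Znull by blast
  moreover have "A \<union> Z = {0<..<2*pi}" by (auto simp: A_def Z_def)
  ultimately have "emeasure lborel {0<..<2*pi} = 0" by auto
  then show False by (simp add: emeasure_lborel_Ioo)
qed

text \<open>The definite description defining the orthogonal polynomial has a unique solution: the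
  difference of two candidates has degree below \<open>n\<close> and is orthogonal to all powers up to its degree.\<close>

lemma monic_opuc_eqI:
  assumes pos: "\<And>\<theta>. \<theta> \<in> {0<..<2*pi} \<Longrightarrow> w \<theta> > 0"
    and p: "degree p = n" "lead_coeff p = 1" "\<And>k. k < n \<Longrightarrow> circle_inner w (poly p) (\<lambda>z. z ^ k) = 0"
  shows "monic_opuc w n = p"
  unfolding monic_opuc_def
proof (rule the_equality)
  fix q :: "complex poly"
  assume q: "degree q = n \<and> lead_coeff q = 1 \<and> (\<forall>k<n. circle_inner w (poly q) (\<lambda>z. z ^ k) = 0)"
  have deg: "q - p = 0 \<or> degree (q - p) < n"
  proof (cases "n = 0")
    case True
    then show ?thesis using p q by (metis degree_0_id diff_self)
  next
    case False
    have "degree (q - p) < n" if "q - p \<noteq> 0"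
    proof -
      have "degree (q - p) \<le> n" using p q by (intro degree_diff_le) auto
      moreover have "degree (q - p) \<noteq> n"
        using p q that by (metis coeff_diff diff_self leading_coeff_0_iff)
      ultimately show ?thesis by simp
    qed
    then show ?thesis by blast
  qed
  have "q - p = 0"
  proof (cases "q - p = 0")
    case False
    show ?thesis
      by (rule orthogonal_to_powers_imp_zero[OF pos])
         (use False deg p(3) q in \<open>auto simp: circle_inner_power circle_inner_poly_diff\<close>)
  qed
  then show "q = p" by simp
qed (use p in auto)

end

section \<open>The circular Jacobi weight\<close>

text \<open>The case \<open>c = tau b\<close> is the probability density when \<open>Re b > - 1/2\<close>.\<close>

definition circular_jacobi_weight :: "real \<Rightarrow> complex \<Rightarrow> real \<Rightarrow> real" where
  "circular_jacobi_weight c b \<theta> = c * exp (- Im b * \<theta>) * ((sin (\<theta> / 2))\<^sup>2) powr Re b"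

lemma circular_jacobi_weight_pos:
  assumes "c > 0" "\<theta> \<in> {0<..<2*pi}"
  shows "circular_jacobi_weight c b \<theta> > 0"
proof -
  have "sin (\<theta> / 2) > 0" using assms by (intro sin_gt_zero) auto
  then show ?thesis using assms by (simp add: circular_jacobi_weight_def)
qed

text \<open>Put \<open>s = sin (\<theta>/2)\<close>. The function \<open>cos (\<theta>/2) s\<^sup>2\<^sup>\<lambda>\<^sup>+\<^sup>1\<close> is continuous on the closed interval, and its
  derivative \<open>(2\<lambda> + 1)/2 s\<^sup>2\<^sup>\<lambda> - (\<lambda> + 1) s\<^sup>2\<^sup>\<lambda>\<^sup>+\<^sup>2\<close> combines the possibly singular \<open>s\<^sup>2\<^sup>\<lambda>\<close> with a
  continuous function. So \<open>s\<^sup>2\<^sup>\<lambda>\<close> is gauge integrable by the fundamental theorem of calculus, and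
  absolutely integrable because it is nonnegative.\<close>

lemma set_integrable_sin_powr:
  fixes lam :: real
  assumes "lam > - 1 / 2"
  shows "set_integrable lborel {0..2*pi} (\<lambda>\<theta>. ((sin (\<theta> / 2))\<^sup>2) powr lam)"
proof -
  define f :: "real \<Rightarrow> real" where "f = (\<lambda>\<theta>. ((sin (\<theta> / 2))\<^sup>2) powr lam)"
  define h :: "real \<Rightarrow> real" where "h = (\<lambda>\<theta>. (sin (\<theta> / 2)) powr (2 * lam + 2))"
  define G :: "real \<Rightarrow> real" where "G = (\<lambda>\<theta>. cos (\<theta> / 2) * sin (\<theta> / 2) powr (2 * lam + 1))"
  have sin0: "sin (\<theta> / 2) \<ge> 0" if "\<theta> \<in> {0..2*pi}" for \<theta> :: real
    using that by (intro sin_ge_zero) auto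
  have f_eq: "f \<theta> = sin (\<theta> / 2) powr (2 * lam)" if "\<theta> \<in> {0..2*pi}" for \<theta>
    using sin0[OF that] by (cases "sin (\<theta> / 2) = 0")
       (auto simp: f_def powr_powr simp flip: powr_numeral)
  have "((\<lambda>\<theta>. (2 * lam + 1) / 2 * f \<theta> - (lam + 1) * h \<theta>) has_integral (G (2*pi) - G 0)) {0..2*pi}"
  proof (rule fundamental_theorem_of_calculus_interior)
    show "continuous_on {0..2*pi} G"
      unfolding G_def using assms sin0 by (intro continuous_intros continuous_on_powr') auto
    fix \<theta> :: real assume \<theta>: "\<theta> \<in> {0<..<2*pi}"
    define s where "s = sin (\<theta> / 2)"
    have s: "s > 0" using \<theta> unfolding s_def by (intro sin_gt_zero) auto
    have c: "(cos (\<theta> / 2))\<^sup>2 = 1 - s\<^sup>2" by (simp add: s_def cos_squared_eq)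
    have p1: "s powr (2 * lam + 1) = s powr (2 * lam) * s"
      and p2: "s powr (2 * lam + 2) = s powr (2 * lam) * s\<^sup>2"
      using s by (simp_all add: powr_add)
    have ds: "((\<lambda>\<theta>. sin (\<theta> / 2)) has_real_derivative cos (\<theta> / 2) / 2) (at \<theta>)"
      and dc: "((\<lambda>\<theta>. cos (\<theta> / 2)) has_real_derivative - s / 2) (at \<theta>)"
      by (auto intro!: derivative_eq_intros simp: s_def)
    have "(G has_real_derivative - s / 2 * s powr (2 * lam + 1) +
        (2 * lam + 1) * s powr (2 * lam) * (cos (\<theta> / 2) / 2) * cos (\<theta> / 2)) (at \<theta>)"
      using DERIV_mult[OF dc DERIV_fun_powr[OF ds, of "2 * lam + 1"]] s
      by (simp add: G_def s_def)
    also have "- s / 2 * s powr (2 * lam + 1) +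
        (2 * lam + 1) * s powr (2 * lam) * (cos (\<theta> / 2) / 2) * cos (\<theta> / 2) =
       s powr (2 * lam) * (- (s\<^sup>2 / 2) + (2 * lam + 1) / 2 * (cos (\<theta> / 2))\<^sup>2)"
      by (simp only: p1 power2_eq_square) (simp add: algebra_simps)
    also have "\<dots> = (2 * lam + 1) / 2 * f \<theta> - (lam + 1) * h \<theta>"
      unfolding c using \<theta> by (simp add: h_def f_eq p2 flip: s_def) (simp add: field_simps)
    finally show "(G has_vector_derivative ((2 * lam + 1) / 2 * f \<theta> - (lam + 1) * h \<theta>)) (at \<theta>)"
      by (simp add: has_real_derivative_iff_has_vector_derivative)
  qed simp
  then have 1: "(\<lambda>\<theta>. (2 * lam + 1) / 2 * f \<theta> - (lam + 1) * h \<theta>) integrable_on {0..2*pi}" by blast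
  have "continuous_on {0..2*pi} h"
    unfolding h_def using assms sin0 by (intro continuous_intros continuous_on_powr') auto
  then have 2: "h integrable_on {0..2*pi}" by (rule integrable_continuous_real)
  have "(\<lambda>\<theta>. 2 / (2 * lam + 1) * ((lam + 1) * h \<theta> +
      ((2 * lam + 1) / 2 * f \<theta> - (lam + 1) * h \<theta>))) integrable_on {0..2*pi}"
    by (intro integrable_on_mult_right integrable_add 1 2)
  then have "f integrable_on {0..2*pi}" using assms by simp
  then have "f absolutely_integrable_on {0..2*pi}"
    by (rule nonnegative_absolutely_integrable_1) (simp add: f_def)
  then have "set_integrable lborel {0..2*pi} f"
    unfolding set_integrable_def by (subst integrable_completion[symmetric]) (auto simp: f_def)
  then show ?thesis by (simp add: f_def)
qed

lemma circular_jacobi_weight_integrable: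
  assumes "Re b > - 1 / 2"
  shows "set_integrable lborel {0..2*pi} (circular_jacobi_weight c b)"
proof -
  have "set_integrable lborel {0..2*pi} (\<lambda>\<theta>. complex_of_real (c * exp (- Im b * \<theta>)) *
      complex_of_real (((sin (\<theta> / 2))\<^sup>2) powr Re b))"
    by (intro set_integrable_continuous_mult_weight set_integrable_sin_powr assms continuous_intros)
  then show ?thesis
    unfolding set_integrable_def circular_jacobi_weight_def
    by (simp add: complex_of_real_integrable_eq scaleR_conv_of_real flip: of_real_mult)
qed

lemma circular_jacobi_weight_deriv:
  assumes "\<theta> \<in> {0<..<2*pi}"
  shows "(circular_jacobi_weight c b has_real_derivative
    circular_jacobi_weight c b \<theta> * (- Im b + Re b * cos (\<theta> / 2) / sin (\<theta> / 2))) (at \<theta>)"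
proof -
  have "sin (\<theta> / 2) > 0" using assms by (intro sin_gt_zero) auto
  then show ?thesis
    unfolding circular_jacobi_weight_def[abs_def]
    by (auto intro!: derivative_eq_intros simp: powr_diff field_simps power2_eq_square)
qed

text \<open>The Pearson equation of the weight. With \<open>z = e\<^sup>i\<^sup>\<theta>\<close> it rests on
  \<open>cot (\<theta>/2) = \<i> (z + 1) / (z - 1)\<close>; the factor \<open>z - 1\<close> clears the pole of the logarithmic derivative.\<close>

lemma cis_minus_one_mult_log_deriv:
  assumes "sin (\<theta> / 2) \<noteq> 0"
  shows "(cis \<theta> - 1) * complex_of_real (- Im b + Re b * cos (\<theta> / 2) / sin (\<theta> / 2)) =
    \<i> * (b * cis \<theta> + cnj b)"
proof -
  define s where "s = sin (\<theta> / 2)"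
  define c where "c = cos (\<theta> / 2)"
  have [simp]: "s \<noteq> 0" using assms by (simp add: s_def)
  have sc: "s * s + c * c = 1"
    using sin_cos_squared_add[of "\<theta> / 2"] by (simp add: s_def c_def power2_eq_square)
  have 1: "cos \<theta> = c * c - s * s" "sin \<theta> = 2 * s * c"
    using cos_add[of "\<theta>/2" "\<theta>/2"] sin_double[of "\<theta>/2"] by (simp_all add: s_def c_def)
  have 2: "c * c = 1 - s * s" using sc by simp
  have 3: "c * (c * x) = x - s * s * x" for x
    by (metis 2 left_diff_distrib mult.assoc mult_1)
  show ?thesis
    unfolding complex_eq_iff
    by (simp add: 1 flip: s_def c_def) (simp add: 2 3 field_simps)
qed

text \<open>The derivative of \<open>F(\<theta>) = (z - 1) z\<^sup>-\<^sup>k p(z) w(\<theta>)\<close> at \<open>z = e\<^sup>i\<^sup>\<theta>\<close> is \<open>\<i> q(z) z\<^sup>-\<^sup>k w(\<theta>)\<close>, where \<open>q\<close> is the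
  difference of the two polynomials in the claim. Since \<open>F\<close> vanishes at both endpoints, \<open>q\<close> is
  orthogonal to \<open>z\<^sup>k\<close>.\<close>

lemma circular_jacobi_weight_by_parts:
  fixes b :: complex and p :: "complex poly"
  assumes "Re b > - 1 / 2"
  shows "circle_inner (circular_jacobi_weight c b)
      (poly ([:cnj b, b + 1:] * p + [:0, -1, 1:] * pderiv p)) (\<lambda>z. z ^ k) =
    of_nat k * circle_inner (circular_jacobi_weight c b) (poly ([:-1, 1:] * p)) (\<lambda>z. z ^ k)"
proof -
  define W where "W = circular_jacobi_weight c b"
  define q where "q = [:cnj b, b + 1:] * p + [:0, -1, 1:] * pderiv p - smult (of_nat k) ([:-1, 1:] * p)"
  define H where "H = (\<lambda>\<theta>. (cis \<theta> - 1) * (cnj (cis \<theta> ^ k) * poly p (cis \<theta>)))"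
  define F where "F = (\<lambda>\<theta>. H \<theta> * complex_of_real (W \<theta>))"
  have W_int: "set_integrable lborel {0..2*pi} W"
    unfolding W_def by (rule circular_jacobi_weight_integrable) fact
  have cnj_pow: "cnj (cis \<theta> ^ k) = cis (- (real k * \<theta>))" for \<theta>
    by (simp only: Complex.DeMoivre cis_cnj)
  \<comment> \<open>Here \<open>z - 1 = 2 \<i> e\<^sup>i\<^sup>\<theta>\<^sup>/\<^sup>2 sin (\<theta>/2)\<close> supplies the power of the sine that makes the exponent
    positive, so that \<open>F\<close> stays continuous where the weight itself may blow up.\<close>
  have cont: "continuous_on {0..2*pi} F"
  proof -
    have sin0: "sin (\<theta> / 2) \<ge> 0" if "\<theta> \<in> {0..2*pi}" for \<theta> :: real
      using that by (intro sin_ge_zero) auto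
    define u where "u = (\<lambda>\<theta>. sin (\<theta> / 2) powr (2 * Re b + 1))"
    have u: "continuous_on {0..2*pi} u"
      unfolding u_def using assms sin0 by (intro continuous_on_powr' continuous_intros) auto
    have *: "continuous_on {0..2*pi} (\<lambda>\<theta>. 2 * \<i> * cis (\<theta> / 2) *
        (cnj (cis \<theta> ^ k) * poly p (cis \<theta>)) * complex_of_real (c * exp (- Im b * \<theta>) * u \<theta>))"
      by (intro continuous_intros u) auto
    show ?thesis
    proof (rule continuous_on_eq[OF *])
      fix \<theta> :: real assume \<theta>: "\<theta> \<in> {0..2*pi}"
      have sq: "(sin (\<theta> / 2))\<^sup>2 powr Re b * sin (\<theta> / 2) = sin (\<theta> / 2) powr (2 * Re b + 1)"
        using sin0[OF \<theta>] by (cases "sin (\<theta> / 2) = 0")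
          (auto simp: powr_powr powr_add simp flip: powr_numeral)
      have z1: "cis \<theta> - 1 = 2 * \<i> * cis (\<theta> / 2) * complex_of_real (sin (\<theta> / 2))"
        using cos_double_sin[of "\<theta> / 2"] sin_double[of "\<theta> / 2"]
        by (simp add: complex_eq_iff power2_eq_square)
      show "2 * \<i> * cis (\<theta> / 2) * (cnj (cis \<theta> ^ k) * poly p (cis \<theta>)) *
          complex_of_real (c * exp (- Im b * \<theta>) * u \<theta>) = F \<theta>"
        unfolding u_def F_def H_def W_def z1 circular_jacobi_weight_def sq[symmetric]
        by (simp add: mult_ac)
    qed
  qed
  define f' where "f' = (\<lambda>\<theta>. \<i> * (poly q (cis \<theta>) * cnj (cis \<theta> ^ k) * complex_of_real (W \<theta>)))"
  have deriv: "(F has_vector_derivative f' \<theta>) (at \<theta>)" if \<theta>: "\<theta> \<in> {0<..<2*pi}" for \<theta>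
  proof -
    have s: "sin (\<theta> / 2) > 0" using \<theta> by (intro sin_gt_zero) auto
    let ?z = "cis \<theta>" and ?u = "cis (- (real k * \<theta>))"
    let ?l = "- Im b + Re b * cos (\<theta> / 2) / sin (\<theta> / 2)"
    have dz: "(cis has_vector_derivative \<i> * ?z) (at \<theta>)"
      by (auto simp: has_vector_derivative_def intro!: derivative_eq_intros)
    have du: "((\<lambda>\<theta>. cis (- (real k * \<theta>))) has_vector_derivative - (\<i> * of_nat k * ?u)) (at \<theta>)"
      by (auto simp: has_vector_derivative_def scaleR_conv_of_real intro!: derivative_eq_intros)
    have dp: "((\<lambda>\<theta>. poly p (cis \<theta>)) has_vector_derivative \<i> * ?z * poly (pderiv p) ?z) (at \<theta>)"
      using field_vector_diff_chain_at[OF dz poly_DERIV[of p ?z]] by (simp add: o_def)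
    have dW: "((\<lambda>\<theta>. complex_of_real (W \<theta>)) has_vector_derivative complex_of_real (W \<theta> * ?l)) (at \<theta>)"
      using circular_jacobi_weight_deriv[OF \<theta>, of c b] unfolding W_def
      by (intro has_vector_derivative_of_real)
         (auto simp: has_real_derivative_iff_has_vector_derivative)
    have dz1: "((\<lambda>\<theta>. cis \<theta> - 1) has_vector_derivative \<i> * ?z) (at \<theta>)"
      using has_vector_derivative_diff[OF dz has_vector_derivative_const[of 1]] by simp
    have "(F has_vector_derivative
        H \<theta> * complex_of_real (W \<theta> * ?l) +
         ((?z - 1) * (?u * (\<i> * ?z * poly (pderiv p) ?z) + - (\<i> * of_nat k * ?u) * poly p ?z) +
          \<i> * ?z * (?u * poly p ?z)) * complex_of_real (W \<theta>)) (at \<theta>)"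
      unfolding F_def H_def cnj_pow
      by (intro has_vector_derivative_mult dz1 du dp dW)
    also have "H \<theta> * complex_of_real (W \<theta> * ?l) =
        ((?z - 1) * complex_of_real ?l) * ?u * poly p ?z * complex_of_real (W \<theta>)"
      unfolding H_def cnj_pow of_real_mult by (simp only: mult_ac)
    also have "(?z - 1) * complex_of_real ?l = \<i> * (b * ?z + cnj b)"
      by (rule cis_minus_one_mult_log_deriv) (use s in simp)
    also have "\<i> * (b * ?z + cnj b) * ?u * poly p ?z * complex_of_real (W \<theta>) +
         ((?z - 1) * (?u * (\<i> * ?z * poly (pderiv p) ?z) + - (\<i> * of_nat k * ?u) * poly p ?z) +
          \<i> * ?z * (?u * poly p ?z)) * complex_of_real (W \<theta>) = f' \<theta>"
      unfolding f'_def q_def cnj_pow by (simp add: algebra_simps)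
    finally show ?thesis .
  qed
  have "(f' has_integral (F (2*pi) - F 0)) {0..2*pi}"
    by (rule fundamental_theorem_of_calculus_interior[OF _ cont deriv]) auto
  then have "integral {0..2*pi} f' = 0"
    by (simp add: F_def H_def integral_unique)
  moreover have "(LINT \<theta>:{0..2*pi}|lborel. f' \<theta>) = integral {0..2*pi} f'"
    using circle_inner_set_integrable[OF W_int, of q "monom 1 k"]
    by (intro set_borel_integral_eq_integral) (simp add: f'_def poly_monom)
  moreover have "(LINT \<theta>:{0..2*pi}|lborel. f' \<theta>) = \<i> * circle_inner W (poly q) (\<lambda>z. z ^ k)"
    unfolding f'_def circle_inner_def by (rule set_integral_mult_right)
  ultimately have "circle_inner W (poly q) (\<lambda>z. z ^ k) = 0" by simp
  then show ?thesis
    unfolding q_def W_def[symmetric] circle_inner_power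
    by (simp only: circle_inner_poly_diff[OF W_int] circle_inner_poly_smult[OF W_int]
         right_minus_eq)
qed

section \<open>The orthogonal polynomials and their Verblunsky coefficients\<close>

text \<open>The circular Jacobi polynomials up to a factor; in closed form
  \<open>\<Sum>\<^sub>j (n choose j) (cnj b)\<^sub>n\<^sub>-\<^sub>j (b + 1)\<^sub>j z\<^sup>j\<close>. The raising operator is used as the definition because
  it matches the integration by parts.\<close>

fun circular_jacobi_poly :: "complex \<Rightarrow> nat \<Rightarrow> complex poly" where
  "circular_jacobi_poly b 0 = 1"
| "circular_jacobi_poly b (Suc n) =
     [:cnj b + of_nat n, b + 1:] * circular_jacobi_poly b n + [:0, -1, 1:] * pderiv (circular_jacobi_poly b n)"

lemma poly_circular_jacobi_poly_0: "poly (circular_jacobi_poly b n) 0 = pochhammer (cnj b) n"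
  by (induction n) (simp_all add: pochhammer_Suc mult.commute)

lemma coeff_circular_jacobi_poly:
  "coeff (circular_jacobi_poly b n) n = pochhammer (b + 1) n \<and>
   (\<forall>j>n. coeff (circular_jacobi_poly b n) j = 0)"
proof (induction n)
  case (Suc n)
  let ?p = "circular_jacobi_poly b n"
  have "coeff (circular_jacobi_poly b (Suc n)) (Suc i) =
      (cnj b + of_nat n - of_nat (Suc i)) * coeff ?p (Suc i) + (b + 1 + of_nat i) * coeff ?p i" for i
    by (cases i) (simp_all add: coeff_pderiv algebra_simps)
  note step = this
  have "coeff (circular_jacobi_poly b (Suc n)) j = 0" if "j > Suc n" for j
    using that Suc by (cases j) (simp_all only: step, auto)
  then show ?case using Suc by (auto simp only: step) (simp add: pochhammer_Suc mult.commute)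
qed auto

text \<open>At \<open>k = 0\<close> the truncated exponent \<open>k - 1\<close> is harmless, since its term carries the factor \<open>k\<close>.\<close>

lemma circular_jacobi_poly_recurrence:
  fixes b :: complex and c :: real
  assumes "Re b > - 1 / 2"
  defines "W \<equiv> circular_jacobi_weight c b"
  shows "circle_inner W (poly (circular_jacobi_poly b (Suc n))) (\<lambda>z. z ^ k) =
    (of_nat n - of_nat k) * circle_inner W (poly (circular_jacobi_poly b n)) (\<lambda>z. z ^ k) +
    of_nat k * circle_inner W (poly (circular_jacobi_poly b n)) (\<lambda>z. z ^ (k - 1))"
proof -
  let ?p = "circular_jacobi_poly b n"
  have W_int: "set_integrable lborel {0..2*pi} W"
    unfolding W_def by (rule circular_jacobi_weight_integrable) fact
  note lin = circle_inner_power circle_inner_poly_add[OF W_int] circle_inner_poly_diff[OF W_int]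
     circle_inner_poly_smult[OF W_int]
  have shift: "of_nat k * circle_inner W (poly (pCons 0 ?p)) (\<lambda>z. z ^ k) =
      of_nat k * circle_inner W (poly ?p) (\<lambda>z. z ^ (k - 1))"
  proof (cases k)
    case (Suc l)
    have "cis \<theta> * x * cnj (cis \<theta> * y) = x * cnj y" for x y \<theta>
    proof -
      have "cis \<theta> * x * cnj (cis \<theta> * y) = (cis \<theta> * cnj (cis \<theta>)) * (x * cnj y)"
        by (simp only: complex_cnj_mult mult_ac)
      also have "cis \<theta> * cnj (cis \<theta>) = 1"
        by (simp only: complex_norm_square[symmetric] norm_cis) simp
      finally show ?thesis by simp
    qed
    then have "circle_inner W (poly (pCons 0 ?p)) (\<lambda>z. z ^ Suc l) = circle_inner W (poly ?p) (\<lambda>z. z ^ l)"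
      unfolding circle_inner_def poly_pCons power_Suc add_0 by (simp only:)
    then show ?thesis by (simp add: Suc)
  qed simp
  have P: "circular_jacobi_poly b (Suc n) =
      ([:cnj b, b + 1:] * ?p + [:0, -1, 1:] * pderiv ?p) + smult (of_nat n) ?p"
    by (simp add: smult_add_left)
  have Q: "[:-1, 1:] * ?p = pCons 0 ?p - ?p" by simp
  have "circle_inner W (poly (circular_jacobi_poly b (Suc n))) (\<lambda>z. z ^ k) =
      of_nat k * circle_inner W (poly ([:-1, 1:] * ?p)) (\<lambda>z. z ^ k) +
      of_nat n * circle_inner W (poly ?p) (\<lambda>z. z ^ k)"
    using circular_jacobi_weight_by_parts[OF assms(1), of c ?p k, folded W_def]
    unfolding P by (simp only: lin)
  moreover have "circle_inner W (poly ([:-1, 1:] * ?p)) (\<lambda>z. z ^ k) =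
      circle_inner W (poly (pCons 0 ?p)) (\<lambda>z. z ^ k) - circle_inner W (poly ?p) (\<lambda>z. z ^ k)"
    unfolding Q by (simp only: lin)
  moreover have "x * (u - v) + y * v = (y - x) * v + x * u" for x y u v :: complex
    by (simp add: algebra_simps)
  ultimately show ?thesis by (simp only: shift)
qed

text \<open>In the recurrence from \<open>n\<close> to \<open>n + 1\<close> the only new exponent is \<open>k = n\<close>, where the factor \<open>n - k\<close>
  vanishes.\<close>

lemma circular_jacobi_poly_orthogonal:
  assumes "Re b > - 1 / 2" "k < n"
  shows "circle_inner (circular_jacobi_weight c b) (poly (circular_jacobi_poly b n)) (\<lambda>z. z ^ k) = 0"
  using assms(2)
proof (induction n arbitrary: k)
  case (Suc n)
  have "(of_nat n - of_nat k) * circle_inner (circular_jacobi_weight c b) (poly (circular_jacobi_poly b n)) (\<lambda>z. z ^ k) = 0"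
    using Suc by (cases "k = n") auto
  moreover have "of_nat k * circle_inner (circular_jacobi_weight c b) (poly (circular_jacobi_poly b n)) (\<lambda>z. z ^ (k - 1)) = 0"
    using Suc.IH[of "k - 1"] Suc.prems by (cases "k = 0") auto
  ultimately show ?case unfolding circular_jacobi_poly_recurrence[OF assms(1)] by (simp only: add_0)
qed simp

lemma pochhammer_Re_pos_nonzero:
  fixes a :: complex
  assumes "Re a > 0"
  shows "pochhammer a n \<noteq> 0"
proof
  assume "pochhammer a n = 0"
  then obtain k where "a = - of_nat k" by (auto simp: pochhammer_eq_0_iff)
  with assms show False by simp
qed

theorem monic_opuc_circular_jacobi:
  assumes "Re b > - 1 / 2" "c > 0"
  shows "monic_opuc (circular_jacobi_weight c b) n =
    smult (1 / pochhammer (b + 1) n) (circular_jacobi_poly b n)"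
proof (rule monic_opuc_eqI)
  have nz: "pochhammer (b + 1) n \<noteq> 0" using assms by (intro pochhammer_Re_pos_nonzero) simp
  show int: "set_integrable lborel {0..2*pi} (circular_jacobi_weight c b)"
    by (rule circular_jacobi_weight_integrable) fact
  have "degree (circular_jacobi_poly b n) = n"
    using coeff_circular_jacobi_poly[of b n] nz
    by (intro antisym degree_le le_degree) auto
  then show deg: "degree (smult (1 / pochhammer (b + 1) n) (circular_jacobi_poly b n)) = n"
    using nz by simp
  show "lead_coeff (smult (1 / pochhammer (b + 1) n) (circular_jacobi_poly b n)) = 1"
    unfolding deg using coeff_circular_jacobi_poly[of b n] nz by simp
  fix k assume "k < n"
  then show "circle_inner (circular_jacobi_weight c b)
      (poly (smult (1 / pochhammer (b + 1) n) (circular_jacobi_poly b n))) (\<lambda>z. z ^ k) = 0"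
    unfolding circle_inner_poly_smult[OF int]
    by (simp add: circular_jacobi_poly_orthogonal[OF assms(1)])
qed (rule circular_jacobi_weight_pos[OF assms(2)])

text \<open>At \<open>n = 0\<close> this is the convention \<open>\<alpha>\<^sub>-\<^sub>1 = - 1\<close>.\<close>

lemma verblunsky_circular_jacobi:
  assumes "Re b > - 1 / 2" "c > 0"
  shows "verblunsky (circular_jacobi_weight c b) (int n - 1) = - pochhammer b n / pochhammer (cnj b + 1) n"
proof -
  have "cnj (pochhammer a n) = pochhammer (cnj a) n" for a
    by (induction n) (simp_all add: pochhammer_Suc)
  then show ?thesis
    by (simp add: verblunsky_def monic_opuc_circular_jacobi[OF assms] poly_circular_jacobi_poly_0)
qed

lemma tau_pos:
  assumes "Re b > - 1 / 2"
  shows "tau b > 0"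
proof -
  have "b + 1 \<notin> \<int>\<^sub>\<le>\<^sub>0"
    using assms by (auto elim!: nonpos_Ints_cases simp: complex_eq_iff)
  then have "Gamma (b + 1) \<noteq> 0" by (simp add: Gamma_eq_zero_iff)
  moreover have "Gamma (Re (b + cnj b) + 1) > 0"
    using assms by (intro Gamma_real_pos) simp
  ultimately show ?thesis by (simp add: tau_def)
qed

text \<open>The numerator \<open>(b)\<^sub>n\<close> and the denominator \<open>(cnj b + 1)\<^sub>n\<close> have, up to conjugation, the same factors
  except for \<open>b\<close> and \<open>b + n\<close>. At \<open>n = 0\<close> the formula can fail, when \<open>b = 0\<close>.\<close>

lemma cmod_verblunsky_circular_jacobi_square:
  assumes "Re b > - 1 / 2" "c > 0" "n \<ge> 1"
  shows "(cmod (verblunsky (circular_jacobi_weight c b) (int n - 1)))\<^sup>2 = (cmod b)\<^sup>2 / (cmod (b + of_nat n))\<^sup>2"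
proof -
  have *: "cmod (pochhammer b m) * cmod (b + of_nat m) = cmod (pochhammer (cnj b + 1) m) * cmod b" for m
  proof (induction m)
    case (Suc m)
    have "cmod (cnj b + 1 + of_nat m) = cmod (b + of_nat (Suc m))"
      by (subst complex_mod_cnj[symmetric]) (simp add: algebra_simps)
    then show ?case using Suc by (simp add: pochhammer_Suc norm_mult mult_ac)
  qed simp
  have "pochhammer (cnj b + 1) n \<noteq> 0" using assms by (intro pochhammer_Re_pos_nonzero) simp
  moreover have "b + of_nat n \<noteq> 0" using assms by (auto simp: complex_eq_iff)
  ultimately have "cmod (verblunsky (circular_jacobi_weight c b) (int n - 1)) = cmod b / cmod (b + of_nat n)"
    using *[of n] by (simp add: verblunsky_circular_jacobi[OF assms(1,2)] norm_divide field_simps)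
  then show ?thesis by (simp add: power_divide)
qed

lemma verblunsky_circular_jacobi_recurrence:
  assumes "Re b > - 1 / 2" "c > 0"
  shows "(cnj b + of_nat n + 1) * verblunsky (circular_jacobi_weight c b) (int n) =
     (b + of_nat n) * verblunsky (circular_jacobi_weight c b) (int n - 1)"
proof -
  have "verblunsky (circular_jacobi_weight c b) (int n) =
      - (pochhammer b n * (b + of_nat n)) / (pochhammer (cnj b + 1) n * (cnj b + 1 + of_nat n))"
    using verblunsky_circular_jacobi[OF assms, of "Suc n"] by (simp add: pochhammer_Suc)
  moreover have "cnj b + 1 + of_nat n \<noteq> 0" using assms by (auto simp: complex_eq_iff)
  moreover have "cnj b + of_nat n + 1 = cnj b + 1 + of_nat n" by simp
  ultimately show ?thesis
    by (simp only: verblunsky_circular_jacobi[OF assms]) simp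
qed

text \<open>Each summand \<open>cnj \<alpha>\<^sub>j \<alpha>\<^sub>j\<^sub>-\<^sub>1\<close> equals \<open>|b|\<^sup>2 / ((b + j) (b + j + 1))\<close>, so the sum telescopes. The term
  \<open>j = 0\<close> is treated separately, since \<open>b\<close> may vanish.\<close>

lemma verblunsky_sum_circular_jacobi:
  assumes "Re b > - 1 / 2" "c > 0"
  shows "verblunsky_sum (circular_jacobi_weight c b) n = of_nat n * cnj b / (b + of_nat n)"
proof (induction n)
  case (Suc n)
  let ?a = "verblunsky (circular_jacobi_weight c b)"
  have nz: "b + 1 + of_nat n \<noteq> 0" using assms by (auto simp: complex_eq_iff)
  have "cnj (?a (int n)) = (cnj b + of_nat n) * cnj (?a (int n - 1)) / (b + of_nat n + 1)"
    using arg_cong[OF verblunsky_circular_jacobi_recurrence[OF assms, of n], of cnj] nz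
    by (simp add: field_simps)
  then have "cnj (?a (int n)) * ?a (int n - 1) =
      (cnj b + of_nat n) * complex_of_real ((cmod (?a (int n - 1)))\<^sup>2) / (b + of_nat n + 1)"
    by (simp add: complex_norm_square mult_ac del: of_real_power)
  also have "(cnj b + of_nat n) * complex_of_real ((cmod (?a (int n - 1)))\<^sup>2) / (b + of_nat n + 1) =
    of_nat (Suc n) * cnj b / (b + of_nat (Suc n)) - of_nat n * cnj b / (b + of_nat n)"
  proof (cases "n = 0")
    case True
    then show ?thesis using verblunsky_circular_jacobi[OF assms, of 0] by simp
  next
    case False
    then have nz': "b + of_nat n \<noteq> 0" using assms by (auto simp: complex_eq_iff)
    then have nz'': "cnj b + of_nat n \<noteq> 0" by (metis complex_cnj_add complex_cnj_cnj complex_cnj_of_nat complex_cnj_zero_iff)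
    have "complex_of_real ((cmod (?a (int n - 1)))\<^sup>2) = (b * cnj b) / ((b + of_nat n) * (cnj b + of_nat n))"
      using False by (simp add: cmod_verblunsky_circular_jacobi_square[OF assms] complex_norm_square del: of_real_power)
    then show ?thesis using nz nz' nz''
      by (simp add: divide_simps) (simp add: algebra_simps)
  qed
  finally show ?case
    using Suc by (simp add: verblunsky_sum_def)
qed (simp add: verblunsky_sum_def)

section \<open>The difference equations\<close>

theorem theorem4p3:
  fixes \<eta> lam :: real and b :: complex and w :: "real \<Rightarrow> real"
    and \<alpha> :: "int \<Rightarrow> complex" and \<gamma> :: "nat \<Rightarrow> complex"
  assumes lam: "lam > - 1 / 2"
    and b: "b = complex_of_real lam + \<i> * complex_of_real \<eta>"
    and w: "w = (\<lambda>\<theta>. tau b * exp (- \<eta> * \<theta>) * ((sin (\<theta> / 2))\<^sup>2) powr lam)"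
    and \<alpha>: "\<alpha> = verblunsky w"
    and \<gamma>: "\<gamma> = verblunsky_sum w"
  shows
    "(\<forall>n::nat. (b + of_nat n + 1) * \<alpha> (int n) =
        (of_nat n + 2 + cnj b - (b + of_nat n + 1) * cnj (\<alpha> (int n + 1)) * \<alpha> (int n)) *
        (\<alpha> (int n + 1) / (1 - complex_of_real ((cmod (\<alpha> (int n + 1)))\<^sup>2)))) \<and>
     (\<forall>n::nat\<ge>1. (cnj b + of_nat n + 1) * \<alpha> (int n) = (b + of_nat n) * \<alpha> (int n - 1)) \<and>
     (\<forall>n::nat\<ge>2. (cnj b + of_nat n + 1) * \<alpha> (int n) + (b + of_nat n - 1) * \<alpha> (int n - 2) =
        2 * (complex_of_real (Re (\<gamma> n)) + of_nat n) * \<alpha> (int n - 1) /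
        (1 - complex_of_real ((cmod (\<alpha> (int n - 1)))\<^sup>2))) \<and>
     (\<forall>n::nat\<ge>2. (cnj b + of_nat n + 1) * \<alpha> (int n) - (b + of_nat n - 1) * \<alpha> (int n - 2) =
        - (2 * \<i> * complex_of_real (Im (\<gamma> n)) * \<alpha> (int n - 1) /
           (1 - complex_of_real ((cmod (\<alpha> (int n - 1)))\<^sup>2)))) \<and>
     (\<forall>n::nat\<ge>2. (cnj b + of_nat n + 1) * \<alpha> (int n) +
        (b + of_nat n - 1) * (1 - complex_of_real ((cmod (\<alpha> (int n - 1)))\<^sup>2)) * \<alpha> (int n - 2) =
        (of_nat n * cnj b / (b + of_nat n) + b + 2 * of_nat n) * \<alpha> (int n - 1)) \<and>
     (\<forall>n::nat\<ge>2. (cnj b + of_nat n + 1) * \<alpha> (int n) -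
        (b + of_nat n - 1) * (1 - complex_of_real ((cmod (\<alpha> (int n - 1)))\<^sup>2)) * \<alpha> (int n - 2) =
        - (of_nat n * cnj b / (b + of_nat n) - b) * \<alpha> (int n - 1))"
proof -
  define c where "c = tau b"
  have Re_b: "Re b > - 1 / 2" and Im_b: "Im b = \<eta>" and lam_b: "lam = Re b" using lam by (simp_all add: b)
  have c: "c > 0" unfolding c_def by (rule tau_pos) fact
  have w_eq: "w = circular_jacobi_weight c b"
    by (simp add: w c_def circular_jacobi_weight_def[abs_def] Im_b lam_b)
  define r where "r = (\<lambda>n. 1 - complex_of_real ((cmod (\<alpha> (int n - 1)))\<^sup>2))"
  then have r_fold: "1 - complex_of_real ((cmod (\<alpha> (int n - 1)))\<^sup>2) = r n" for n
    by (simp only:)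
  have nz: "b + of_nat n \<noteq> 0" "cnj b + of_nat n \<noteq> 0" if "n \<ge> 1" for n
    using Re_b that by (auto simp: complex_eq_iff)
  have rec: "(cnj b + of_nat n + 1) * \<alpha> (int n) = (b + of_nat n) * \<alpha> (int n - 1)" for n
    unfolding \<alpha> w_eq by (rule verblunsky_circular_jacobi_recurrence[OF Re_b c])
  have rec': "(b + of_nat n - 1) * \<alpha> (int n - 2) = (cnj b + of_nat n) * \<alpha> (int n - 1)" if "n \<ge> 1" for n
    using rec[of "n - 1"] that by (simp add: of_nat_diff algebra_simps)
  have r_eq: "r n = 1 - b * cnj b / ((b + of_nat n) * (cnj b + of_nat n))" if "n \<ge> 1" for n
    unfolding r_def \<alpha> w_eq cmod_verblunsky_circular_jacobi_square[OF Re_b c that]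
    by (simp add: complex_norm_square del: of_real_power)
  have r_mult: "(b + of_nat n) * (cnj b + of_nat n) * r n = of_nat n * (2 * complex_of_real (Re b) + of_nat n)"
    if "n \<ge> 1" for n
  proof -
    have "(b + of_nat n) * (cnj b + of_nat n) * r n =
        (b + of_nat n) * (cnj b + of_nat n) - b * cnj b"
    proof -
      have "u * (1 - v / u) = u - v" if "u \<noteq> 0" for u v :: complex
        using that by (simp add: right_diff_distrib)
      then show ?thesis using nz[OF that] unfolding r_eq[OF that] by simp
    qed
    also have "\<dots> = of_nat n * (b + cnj b + of_nat n)" by (simp add: algebra_simps)
    finally show ?thesis by (simp add: complex_add_cnj)
  qed
  \<comment> \<open>The Verblunsky coefficients have modulus different from 1, so all denominators are nonzero.\<close>
  have r_nz: "r n \<noteq> 0" if "n \<ge> 1" for n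
  proof
    assume "r n = 0"
    with r_mult[OF that] that have "2 * complex_of_real (Re b) + of_nat n = 0" by simp
    then have "2 * Re b + real n = 0" by (simp add: complex_eq_iff)
    with Re_b that show False by (cases n) auto
  qed
  have \<gamma>_eq: "\<gamma> n = of_nat n * cnj b / (b + of_nat n)" for n
    unfolding \<gamma> w_eq by (rule verblunsky_sum_circular_jacobi[OF Re_b c])
  \<comment> \<open>Since \<open>r n\<close> is real, this identity splits into the formulas for both parts of \<open>\<gamma> n\<close>.\<close>
  have \<gamma>_r: "\<gamma> n + of_nat n = (cnj b + of_nat n) * r n" if "n \<ge> 1" for n
  proof -
    have "v * (1 - b * cnj b / (u * v)) = v - b * cnj b / u" if "v \<noteq> 0" for u v :: complex
      using that by (simp add: right_diff_distrib)
    then have "(cnj b + of_nat n) * r n = cnj b + of_nat n - b * cnj b / (b + of_nat n)"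
      using nz[OF that] unfolding r_eq[OF that] by simp
    then show ?thesis using nz(1)[OF that] by (simp add: \<gamma>_eq field_simps)
  qed
  have r_real: "r n = complex_of_real (Re (r n))" for n by (simp add: r_def)
  have Re_\<gamma>: "complex_of_real (Re (\<gamma> n)) + of_nat n = (complex_of_real (Re b) + of_nat n) * r n"
    and Im_\<gamma>: "complex_of_real (Im (\<gamma> n)) = - complex_of_real (Im b) * r n" if "n \<ge> 1" for n
  proof -
    have *: "\<gamma> n + of_nat n = (cnj b + of_nat n) * complex_of_real (Re (r n))"
      using \<gamma>_r[OF that] r_real by metis
    show "complex_of_real (Re (\<gamma> n)) + of_nat n = (complex_of_real (Re b) + of_nat n) * r n"
      using arg_cong[OF *, of Re] by (subst r_real) (simp add: complex_eq_iff)
    show "complex_of_real (Im (\<gamma> n)) = - complex_of_real (Im b) * r n"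
      using arg_cong[OF *, of Im] by (subst r_real) (simp add: complex_eq_iff)
  qed
  have eq1: "(b + of_nat n + 1) * \<alpha> (int n) =
        (of_nat n + 2 + cnj b - (b + of_nat n + 1) * cnj (\<alpha> (int n + 1)) * \<alpha> (int n)) *
        (\<alpha> (int n + 1) / (1 - complex_of_real ((cmod (\<alpha> (int n + 1)))\<^sup>2)))" for n
  proof -
    have R: "1 - complex_of_real ((cmod (\<alpha> (int n + 1)))\<^sup>2) = r (n + 2)"
    proof -
      have "int (n + 2) - 1 = int n + 1" by simp
      then show ?thesis by (simp only: r_def)
    qed
    have "(of_nat n + 2 + cnj b) * \<alpha> (int n + 1) = (b + of_nat n + 1) * \<alpha> (int n)"
    proof -
      have "int (n + 1) = int n + 1" "int (n + 1) - 1 = int n"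
        "cnj b + of_nat (n + 1) + 1 = of_nat n + 2 + cnj b" "b + of_nat (n + 1) = b + of_nat n + 1"
        by simp_all
      then show ?thesis using rec[of "n + 1"] by (simp only:)
    qed
    moreover have "cnj (\<alpha> (int n + 1)) * \<alpha> (int n + 1) = 1 - r (n + 2)"
      unfolding R[symmetric] complex_norm_square by (simp add: mult.commute)
    ultimately have "(of_nat n + 2 + cnj b - (b + of_nat n + 1) * cnj (\<alpha> (int n + 1)) * \<alpha> (int n)) * \<alpha> (int n + 1)
        = (b + of_nat n + 1) * \<alpha> (int n) * r (n + 2)"
      by algebra
    then show ?thesis unfolding R using r_nz[of "n + 2"] by simp
  qed
  have eq3: "(cnj b + of_nat n + 1) * \<alpha> (int n) + (b + of_nat n - 1) * \<alpha> (int n - 2) =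
        2 * (complex_of_real (Re (\<gamma> n)) + of_nat n) * \<alpha> (int n - 1) /
        (1 - complex_of_real ((cmod (\<alpha> (int n - 1)))\<^sup>2))" if "n \<ge> 2" for n
  proof -
    have n1: "n \<ge> 1" using that by simp
    have "(cnj b + of_nat n + 1) * \<alpha> (int n) + (b + of_nat n - 1) * \<alpha> (int n - 2) =
       (b + cnj b + 2 * of_nat n) * \<alpha> (int n - 1)"
      unfolding rec rec'[OF n1] by (simp add: algebra_simps)
    also have "b + cnj b + 2 * of_nat n = 2 * (complex_of_real (Re b) + of_nat n)"
      by (simp add: complex_add_cnj)
    finally show ?thesis
      unfolding r_fold Re_\<gamma>[OF n1] using r_nz[OF n1] by simp
  qed
  have eq4: "(cnj b + of_nat n + 1) * \<alpha> (int n) - (b + of_nat n - 1) * \<alpha> (int n - 2) =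
        - (2 * \<i> * complex_of_real (Im (\<gamma> n)) * \<alpha> (int n - 1) /
           (1 - complex_of_real ((cmod (\<alpha> (int n - 1)))\<^sup>2)))" if "n \<ge> 2" for n
  proof -
    have n1: "n \<ge> 1" using that by simp
    have "(cnj b + of_nat n + 1) * \<alpha> (int n) - (b + of_nat n - 1) * \<alpha> (int n - 2) =
       (b - cnj b) * \<alpha> (int n - 1)"
      unfolding rec rec'[OF n1] by (simp add: algebra_simps)
    also have "b - cnj b = 2 * \<i> * complex_of_real (Im b)"
      by (simp add: complex_diff_cnj)
    finally show ?thesis
      unfolding r_fold Im_\<gamma>[OF n1] using r_nz[OF n1] by simp
  qed
  have split: "(b + of_nat n - 1) * r n * \<alpha> (int n - 2) =
      (of_nat n * cnj b / (b + of_nat n) + of_nat n) * \<alpha> (int n - 1)" if "n \<ge> 2" for n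
  proof -
    have n1: "n \<ge> 1" using that by simp
    have "(b + of_nat n - 1) * r n * \<alpha> (int n - 2) = r n * ((cnj b + of_nat n) * \<alpha> (int n - 1))"
      unfolding rec'[OF n1, symmetric] by (simp only: mult_ac)
    also have "\<dots> = (\<gamma> n + of_nat n) * \<alpha> (int n - 1)"
      unfolding \<gamma>_r[OF n1] by (simp only: mult_ac)
    finally show ?thesis unfolding \<gamma>_eq .
  qed
  have eq5: "(cnj b + of_nat n + 1) * \<alpha> (int n) +
        (b + of_nat n - 1) * (1 - complex_of_real ((cmod (\<alpha> (int n - 1)))\<^sup>2)) * \<alpha> (int n - 2) =
        (of_nat n * cnj b / (b + of_nat n) + b + 2 * of_nat n) * \<alpha> (int n - 1)"
    and eq6: "(cnj b + of_nat n + 1) * \<alpha> (int n) -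
        (b + of_nat n - 1) * (1 - complex_of_real ((cmod (\<alpha> (int n - 1)))\<^sup>2)) * \<alpha> (int n - 2) =
        - (of_nat n * cnj b / (b + of_nat n) - b) * \<alpha> (int n - 1)" if "n \<ge> 2" for n
    unfolding rec r_fold split[OF that] by (simp_all add: algebra_simps)
  show ?thesis using eq1 rec eq3 eq4 eq5 eq6 by blast
qed

end
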